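(* Let $T$ be an invertible ergodic measure preserving transformation on a Lebesgue probability space $(X,\mathcal{B},\mu)$. If $T$ has discrete spectrum, then $T$ has no over-recurrent sets; that is, there is no measurable set $A$ with $0<\mu(A)<1$ such that $\mu(T^nA\cap A)\geq\mu(A)^2$ for all $n\in\mathbb{Z}$.
   Context: A Lebesgue probability space is a (non-atomic) standard probability space, i.e. isomorphic mod null sets to $[0,1]$ with Lebesgue measure. $T$ has discrete spectrum if $L^2(X,\mu)$ is the closed linear span of the eigenfunctions of the unitary operator $f\mapsto f\circ T$. A measurable set $A$ with $0<\mu(A)<1$ is over-recurrent for $T$ if $\mu(T^nA\cap A)\geq\mu(A)^2$ for all $n\in\mathbb{Z}$. *)

theory Defs
  imports "HOL-Probability.Probability"
begin

definition isomorphic_mod_null :: "'a measure \<Rightarrow> 'b measure \<Rightarrow> bool" where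
  "isomorphic_mod_null M N \<longleftrightarrow>
     (\<exists>X Y \<phi> \<psi>. X \<in> sets M \<and> space M - X \<in> null_sets M
        \<and> Y \<in> sets N \<and> space N - Y \<in> null_sets N
        \<and> \<phi> \<in> restrict_space M X \<rightarrow>\<^sub>M restrict_space N Y
        \<and> \<psi> \<in> restrict_space N Y \<rightarrow>\<^sub>M restrict_space M X
        \<and> (\<forall>x\<in>X. \<psi> (\<phi> x) = x) \<and> (\<forall>y\<in>Y. \<phi> (\<psi> y) = y)
        \<and> distr (restrict_space M X) (restrict_space N Y) \<phi> = restrict_space N Y)"

(* The completion admits both conventions in use: M may be a Borel (non-complete) probability
   space, or it may already be complete, in which case the completion has no effect. *)
definition lebesgue_probability_space :: "'a measure \<Rightarrow> bool" where
  "lebesgue_probability_space M \<longleftrightarrow>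
     prob_space M \<and> isomorphic_mod_null (completion M) (lebesgue_on {0..1::real})"

definition invertible_mpt :: "'a measure \<Rightarrow> ('a \<Rightarrow> 'a) \<Rightarrow> bool" where
  "invertible_mpt M T \<longleftrightarrow>
     bij_betw T (space M) (space M)
     \<and> T \<in> M \<rightarrow>\<^sub>M M \<and> inv_into (space M) T \<in> M \<rightarrow>\<^sub>M M
     \<and> distr M M T = M"

definition ergodic :: "'a measure \<Rightarrow> ('a \<Rightarrow> 'a) \<Rightarrow> bool" where
  "ergodic M T \<longleftrightarrow>
     (\<forall>A\<in>sets M. T -` A \<inter> space M = A \<longrightarrow> measure M A = 0 \<or> measure M A = 1)"

(* Elements of L^2 are represented by functions; equality in L^2 is equality almost everywhere. *)
definition L2_functions :: "'a measure \<Rightarrow> ('a \<Rightarrow> complex) set" where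
  "L2_functions M =
     {f \<in> borel_measurable M. integrable M (\<lambda>x. (cmod (f x))\<^sup>2)}"

definition L2_seminorm :: "'a measure \<Rightarrow> ('a \<Rightarrow> complex) \<Rightarrow> real" where
  "L2_seminorm M f = sqrt (\<integral>x. (cmod (f x))\<^sup>2 \<partial>M)"

definition eigenfunction :: "'a measure \<Rightarrow> ('a \<Rightarrow> 'a) \<Rightarrow> ('a \<Rightarrow> complex) \<Rightarrow> bool" where
  "eigenfunction M T f \<longleftrightarrow>
     f \<in> L2_functions M \<and> \<not> (AE x in M. f x = 0)
     \<and> (\<exists>z::complex. AE x in M. f (T x) = z * f x)"

(* Only density is required: the span of the eigenfunctions lies in L^2 automatically. *)
definition discrete_spectrum :: "'a measure \<Rightarrow> ('a \<Rightarrow> 'a) \<Rightarrow> bool" where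
  "discrete_spectrum M T \<longleftrightarrow>
     (\<forall>f\<in>L2_functions M. \<forall>\<epsilon>>0. \<exists>E c. finite E \<and> (\<forall>e\<in>E. eigenfunction M T e)
        \<and> L2_seminorm M (\<lambda>x. f x - (\<Sum>e\<in>E. c e * e x)) < \<epsilon>)"

definition int_iterate :: "'a measure \<Rightarrow> ('a \<Rightarrow> 'a) \<Rightarrow> int \<Rightarrow> 'a \<Rightarrow> 'a" where
  "int_iterate M T n =
     (if n \<ge> 0 then T ^^ nat n else inv_into (space M) T ^^ nat (- n))"

definition over_recurrent :: "'a measure \<Rightarrow> ('a \<Rightarrow> 'a) \<Rightarrow> 'a set \<Rightarrow> bool" where
  "over_recurrent M T A \<longleftrightarrow>
     A \<in> sets M \<and> 0 < measure M A \<and> measure M A < 1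
     \<and> (\<forall>n::int. measure M (int_iterate M T n ` A \<inter> A) \<ge> (measure M A)\<^sup>2)"

end

theory Submission
  imports Defs
begin

text \<open>
  Suppose that \<open>A\<close> is over-recurrent and let \<open>f = 1\<^sub>A - \<mu>(A)\<close>. The autocorrelations
  \<open>\<gamma>(n) = \<integral> f(T\<^sup>n x) f(x) d\<mu> = \<mu>(T\<^sup>-\<^sup>n A \<inter> A) - \<mu>(A)\<^sup>2\<close> are then nonnegative, and this
  forces \<open>f\<close> to be orthogonal to every eigenfunction, for the following reason.

  Expanding the square norm of \<open>\<Sum>\<^sub>n\<^sub><\<^sub>N w\<^sup>n f \<circ> T\<^sup>n\<close> gives a double sum of terms
  \<open>w\<^sup>n cnj(w)\<^sup>m \<gamma>(\<bar>n - m\<bar>)\<close>. If all \<open>\<gamma>\<close> are nonnegative, then for \<open>\<bar>w\<bar> \<le> 1\<close> the sum is at most its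
  value at \<open>w = 1\<close>: twisting the ergodic averages of \<open>f\<close> cannot increase their norm
  (\<open>twisted_average_dominated\<close>). The untwisted averages tend to \<open>\<integral> f = 0\<close> in \<open>L\<^sup>2\<close> by the mean
  ergodic theorem (\<open>mean_ergodic_discrete_spectrum\<close>), so all twisted averages tend to \<open>0\<close> as well. If
  \<open>e\<close> is an eigenfunction with eigenvalue \<open>z\<close>, then \<open>f\<close> and its averages twisted by
  \<open>w = cnj z\<close> have the same inner product with \<open>e\<close> (\<open>inner_twisted_average\<close>), whence
  this inner product is \<open>0\<close>.

  When the eigenfunctions span \<open>L\<^sup>2\<close> it follows that \<open>f = 0\<close>, which contradicts
  \<open>\<integral> f\<^sup>2 = \<mu>(A) (1 - \<mu>(A)) > 0\<close>. Discrete spectrum also makes the mean ergodic theorem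
  elementary: for an eigenfunction the averages are either a geometric sum or, by ergodicity,
  constant, and the general case follows by approximation.
\<close>

section \<open>Square-integrable functions\<close>

lemma L2_measurable [measurable_dest]: "f \<in> L2_functions M \<Longrightarrow> f \<in> borel_measurable M"
  by (simp add: L2_functions_def)

lemma L2_integrable_norm2: "f \<in> L2_functions M \<Longrightarrow> integrable M (\<lambda>x. (cmod (f x))\<^sup>2)"
  by (simp add: L2_functions_def)

lemma borel_measurable_cnj [measurable (raw)]:
  "f \<in> borel_measurable M \<Longrightarrow> (\<lambda>x. cnj (f x)) \<in> borel_measurable M"
  by (rule borel_measurable_continuous_on) (intro continuous_intros)

lemma cmod_add_squared_le:
  "(cmod (a + b))\<^sup>2 \<le> 2 * (cmod a)\<^sup>2 + 2 * (cmod b)\<^sup>2"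
proof -
  have "(cmod (a + b))\<^sup>2 \<le> (cmod a + cmod b)\<^sup>2"
    by (simp add: norm_triangle_ineq power_mono)
  also have "\<dots> \<le> 2 * (cmod a)\<^sup>2 + 2 * (cmod b)\<^sup>2"
    using sum_squares_bound[of "cmod a" "cmod b"] by (simp add: power2_sum)
  finally show ?thesis .
qed

lemma cmod_sum_squared_le:
  "(cmod (\<Sum>i\<in>I. a i))\<^sup>2 \<le> real (card I) * (\<Sum>i\<in>I. (cmod (a i))\<^sup>2)"
proof -
  have "(cmod (\<Sum>i\<in>I. a i))\<^sup>2 \<le> (\<Sum>i\<in>I. cmod (a i))\<^sup>2"
    by (simp add: norm_sum power_mono)
  also have "\<dots> \<le> (\<Sum>i\<in>I. (cmod (a i))\<^sup>2) * real (card I)"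
    by (cases "finite I") (use sum_squared_le_sum_of_squares[of "\<lambda>i. cmod (a i)" I] in auto)
  finally show ?thesis by (simp add: mult.commute)
qed

lemma L2_add:
  assumes "f \<in> L2_functions M" "g \<in> L2_functions M"
  shows "(\<lambda>x. f x + g x) \<in> L2_functions M"
proof -
  note [measurable] = assms[THEN L2_measurable]
  have "integrable M (\<lambda>x. (cmod (f x + g x))\<^sup>2)"
    by (rule Bochner_Integration.integrable_bound
        [of _ "\<lambda>x. 2 * (cmod (f x))\<^sup>2 + 2 * (cmod (g x))\<^sup>2"])
       (use assms[THEN L2_integrable_norm2] cmod_add_squared_le in auto)
  then show ?thesis by (simp add: L2_functions_def)
qed

lemma L2_cmult:
  assumes "f \<in> L2_functions M"
  shows "(\<lambda>x. c * f x) \<in> L2_functions M"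
  using assms by (auto simp: L2_functions_def norm_mult power_mult_distrib)

lemma L2_diff:
  assumes "f \<in> L2_functions M" "g \<in> L2_functions M"
  shows "(\<lambda>x. f x - g x) \<in> L2_functions M"
  using L2_add[OF assms(1) L2_cmult[OF assms(2), of "-1"]] by simp

lemma L2_sum:
  assumes "\<And>i. i \<in> I \<Longrightarrow> f i \<in> L2_functions M"
  shows "(\<lambda>x. \<Sum>i\<in>I. f i x) \<in> L2_functions M"
  using assms
proof (induction I rule: infinite_finite_induct)
  case (insert i I)
  then show ?case using L2_add[of "f i" M "\<lambda>x. \<Sum>i\<in>I. f i x"] by simp
qed (simp_all add: L2_functions_def)

lemma (in finite_measure) L2_const: "(\<lambda>_. c) \<in> L2_functions M"
  by (simp add: L2_functions_def)

lemma (in finite_measure) integrable_indicat_real: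
  "A \<in> sets M \<Longrightarrow> integrable M (indicat_real A)"
  by (rule integrable_const_bound[of _ 1]) auto

lemma (in finite_measure) L2_integrable:
  assumes "f \<in> L2_functions M"
  shows "integrable M f"
proof -
  have "integrable M (\<lambda>x. norm (f x))"
    by (rule square_integrable_imp_integrable) (use assms in \<open>auto simp: L2_functions_def\<close>)
  then show ?thesis
    using L2_measurable[OF assms] by (simp add: integrable_norm_iff)
qed

lemma L2_inner_integrable:
  assumes "f \<in> L2_functions M" "g \<in> L2_functions M"
  shows "integrable M (\<lambda>x. f x * cnj (g x))"
proof -
  note [measurable] = assms[THEN L2_measurable]
  have "cmod a * cmod b \<le> (cmod a)\<^sup>2 + (cmod b)\<^sup>2" for a b
    using sum_squares_bound[of "cmod a" "cmod b"]
      mult_nonneg_nonneg[OF norm_ge_zero norm_ge_zero, of a b] by linarith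
  then have bound: "norm (f x * cnj (g x)) \<le> norm ((cmod (f x))\<^sup>2 + (cmod (g x))\<^sup>2)" for x
    by (simp add: norm_mult)
  show ?thesis
    by (rule Bochner_Integration.integrable_bound
        [of _ "\<lambda>x. (cmod (f x))\<^sup>2 + (cmod (g x))\<^sup>2"])
       (use assms[THEN L2_integrable_norm2] bound in auto)
qed

lemma L2_Cauchy_Schwarz:
  assumes "f \<in> L2_functions M" "g \<in> L2_functions M"
  shows "(cmod (\<integral>x. f x * cnj (g x) \<partial>M))\<^sup>2
           \<le> (\<integral>x. (cmod (f x))\<^sup>2 \<partial>M) * (\<integral>x. (cmod (g x))\<^sup>2 \<partial>M)"
proof -
  note [measurable] = assms[THEN L2_measurable]
  note int = assms[THEN L2_integrable_norm2]
  have int_fg: "integrable M (\<lambda>x. cmod (f x) * cmod (g x))"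
    using L2_inner_integrable[OF assms, THEN integrable_norm] by (simp add: norm_mult)
  have "(\<integral>\<^sup>+x. ennreal (cmod (f x)) * ennreal (cmod (g x)) \<partial>M)\<^sup>2
      \<le> (\<integral>\<^sup>+x. (ennreal (cmod (f x)))\<^sup>2 \<partial>M) * (\<integral>\<^sup>+x. (ennreal (cmod (g x)))\<^sup>2 \<partial>M)"
    by (rule Cauchy_Schwarz_nn_integral) measurable
  then have "ennreal ((\<integral>x. cmod (f x) * cmod (g x) \<partial>M)\<^sup>2)
      \<le> ennreal ((\<integral>x. (cmod (f x))\<^sup>2 \<partial>M) * (\<integral>x. (cmod (g x))\<^sup>2 \<partial>M))"
    using int_fg int
    by (simp add: ennreal_mult[symmetric] ennreal_power nn_integral_eq_integral)
  then have *: "(\<integral>x. cmod (f x) * cmod (g x) \<partial>M)\<^sup>2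
      \<le> (\<integral>x. (cmod (f x))\<^sup>2 \<partial>M) * (\<integral>x. (cmod (g x))\<^sup>2 \<partial>M)"
    by (simp add: ennreal_le_iff)
  have "cmod (\<integral>x. f x * cnj (g x) \<partial>M) \<le> (\<integral>x. cmod (f x) * cmod (g x) \<partial>M)"
    using integral_norm_bound[of M "\<lambda>x. f x * cnj (g x)"] by (simp add: norm_mult)
  then show ?thesis
    using * by (smt (verit) norm_ge_zero power_mono)
qed

lemma integral_norm2_add_le:
  assumes "f \<in> L2_functions M" "g \<in> L2_functions M"
  shows "(\<integral>x. (cmod (f x + g x))\<^sup>2 \<partial>M)
           \<le> 2 * (\<integral>x. (cmod (f x))\<^sup>2 \<partial>M) + 2 * (\<integral>x. (cmod (g x))\<^sup>2 \<partial>M)"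
proof -
  note int = assms[THEN L2_integrable_norm2]
  have "(\<integral>x. (cmod (f x + g x))\<^sup>2 \<partial>M)
      \<le> (\<integral>x. 2 * (cmod (f x))\<^sup>2 + 2 * (cmod (g x))\<^sup>2 \<partial>M)"
    by (rule integral_mono) (use int L2_add[OF assms, THEN L2_integrable_norm2] cmod_add_squared_le in auto)
  then show ?thesis using int by simp
qed

lemma integral_norm2_sum_le:
  assumes "\<And>i. i \<in> I \<Longrightarrow> f i \<in> L2_functions M"
  shows "(\<integral>x. (cmod (\<Sum>i\<in>I. f i x))\<^sup>2 \<partial>M)
           \<le> real (card I) * (\<Sum>i\<in>I. \<integral>x. (cmod (f i x))\<^sup>2 \<partial>M)"
proof -
  note int = assms[THEN L2_integrable_norm2]
  have "(\<integral>x. (cmod (\<Sum>i\<in>I. f i x))\<^sup>2 \<partial>M)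
      \<le> (\<integral>x. real (card I) * (\<Sum>i\<in>I. (cmod (f i x))\<^sup>2) \<partial>M)"
    by (rule integral_mono) (use int L2_sum[of I f M, OF assms, THEN L2_integrable_norm2] cmod_sum_squared_le in auto)
  also have "\<dots> = real (card I) * (\<Sum>i\<in>I. \<integral>x. (cmod (f i x))\<^sup>2 \<partial>M)"
    by (simp add: int Bochner_Integration.integral_sum)
  finally show ?thesis .
qed

lemma discrete_spectrum_approx:
  assumes "discrete_spectrum M T" "f \<in> L2_functions M" "\<epsilon> > 0"
  obtains E c where "finite E" "\<And>e. e \<in> E \<Longrightarrow> eigenfunction M T e"
    "(\<integral>x. (cmod (f x - (\<Sum>e\<in>E. c e * e x)))\<^sup>2 \<partial>M) < \<epsilon>"
proof -
  have "sqrt \<epsilon> > 0" using assms(3) by simp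
  from assms(1)[unfolded discrete_spectrum_def, rule_format, OF assms(2) this]
  obtain E c where "finite E" "\<forall>e\<in>E. eigenfunction M T e"
    "L2_seminorm M (\<lambda>x. f x - (\<Sum>e\<in>E. c e * e x)) < sqrt \<epsilon>"
    by (elim exE conjE)
  then show thesis
    by (intro that[of E c]) (auto simp: L2_seminorm_def)
qed

text \<open>If \<open>g\<close> is a combination of eigenfunctions, it is orthogonal to \<open>f\<close>, so by Pythagoras \<open>g\<close> is
  no better an approximation of \<open>f\<close> than \<open>0\<close> is.\<close>

lemma orthogonal_eigenfunctions_imp_zero:
  assumes ds: "discrete_spectrum M T" and f: "f \<in> L2_functions M"
    and orth: "\<And>e. eigenfunction M T e \<Longrightarrow> (\<integral>x. f x * cnj (e x) \<partial>M) = 0"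
  shows "(\<integral>x. (cmod (f x))\<^sup>2 \<partial>M) = 0"
proof (rule ccontr)
  assume "(\<integral>x. (cmod (f x))\<^sup>2 \<partial>M) \<noteq> 0"
  then have "(\<integral>x. (cmod (f x))\<^sup>2 \<partial>M) > 0"
    by (simp add: order.not_eq_order_implies_strict)
  then obtain E c where E: "finite E" "\<And>e. e \<in> E \<Longrightarrow> eigenfunction M T e"
    and less: "(\<integral>x. (cmod (f x - (\<Sum>e\<in>E. c e * e x)))\<^sup>2 \<partial>M) < (\<integral>x. (cmod (f x))\<^sup>2 \<partial>M)"
    by (rule discrete_spectrum_approx[OF ds f]) blast
  define g where "g = (\<lambda>x. \<Sum>e\<in>E. c e * e x)"
  have eL2: "e \<in> L2_functions M" if "e \<in> E" for e
    using E(2)[OF that] by (simp add: eigenfunction_def)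
  have g: "g \<in> L2_functions M"
    unfolding g_def by (intro L2_sum L2_cmult eL2)
  have "(\<integral>x. f x * cnj (g x) \<partial>M) = (\<integral>x. (\<Sum>e\<in>E. cnj (c e) * (f x * cnj (e x))) \<partial>M)"
    by (simp add: g_def sum_distrib_left mult_ac)
  also have "\<dots> = (\<Sum>e\<in>E. cnj (c e) * (\<integral>x. f x * cnj (e x) \<partial>M))"
    by (subst Bochner_Integration.integral_sum) (auto intro!: L2_inner_integrable f eL2)
  also have "\<dots> = 0" using E(2) orth by simp
  finally have fg: "(\<integral>x. f x * cnj (g x) \<partial>M) = 0" .
  have "(\<integral>x. Re (f x * cnj (g x)) \<partial>M) = 0"
    using integral_Re[OF L2_inner_integrable[OF f g]] fg by simp
  moreover have int_Re: "integrable M (\<lambda>x. Re (f x * cnj (g x)))"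
    using L2_inner_integrable[OF f g] by (rule integrable_Re)
  moreover have "(cmod (f x - g x))\<^sup>2
      = (cmod (f x))\<^sup>2 + (cmod (g x))\<^sup>2 - 2 * Re (f x * cnj (g x))" for x
    by (simp only: cmod_power2) (simp add: power2_eq_square algebra_simps)
  ultimately have "(\<integral>x. (cmod (f x - g x))\<^sup>2 \<partial>M)
      = (\<integral>x. (cmod (f x))\<^sup>2 \<partial>M) + (\<integral>x. (cmod (g x))\<^sup>2 \<partial>M)"
    using L2_integrable_norm2[OF f] L2_integrable_norm2[OF g] by (simp del: times_complex.sel complex_cnj minus_complex.sel)
  moreover have "(\<integral>x. (cmod (g x))\<^sup>2 \<partial>M) \<ge> 0" by simp
  ultimately show False using less unfolding g_def by linarith
qed

section \<open>Measure preserving transformations\<close>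

locale measure_preserving = prob_space M for M :: "'a measure" +
  fixes T :: "'a \<Rightarrow> 'a"
  assumes T_measurable [measurable]: "T \<in> M \<rightarrow>\<^sub>M M"
    and T_preserves: "distr M M T = M"
begin

lemma T_iter_measurable [measurable]: "T ^^ n \<in> M \<rightarrow>\<^sub>M M"
  by (rule measurable_compose_n) simp

lemma T_iter_preserves: "distr M M (T ^^ n) = M"
proof (induction n)
  case 0
  then show ?case by (simp add: distr_id2)
next
  case (Suc n)
  have "distr M M (T ^^ Suc n) = distr (distr M M (T ^^ n)) M T"
    by (simp only: funpow.simps distr_distr[OF T_measurable T_iter_measurable])
  then show ?case by (simp only: Suc T_preserves)
qed

lemma T_iter_space: "x \<in> space M \<Longrightarrow> (T ^^ n) x \<in> space M"
  using T_iter_measurable[of n] by (rule measurable_space)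

lemma integral_T_iter:
  fixes f :: "'a \<Rightarrow> 'b::{banach, second_countable_topology}"
  assumes "f \<in> borel_measurable M"
  shows "(\<integral>x. f ((T ^^ n) x) \<partial>M) = (\<integral>x. f x \<partial>M)"
  using integral_distr[OF T_iter_measurable assms, of n] by (simp add: T_iter_preserves)

lemma integrable_T_iter:
  fixes f :: "'a \<Rightarrow> 'b::{banach, second_countable_topology}"
  assumes "integrable M f"
  shows "integrable M (\<lambda>x. f ((T ^^ n) x))"
  using integrable_distr[OF T_iter_measurable, of n f] assms by (simp add: T_iter_preserves)

lemma AE_T_iter:
  assumes "AE x in M. P x"
  shows "AE x in M. P ((T ^^ n) x)"
proof -
  have "AE x in distr M M (T ^^ n). P x"
    using assms by (simp only: T_iter_preserves)
  then show ?thesis by (rule AE_distrD[OF T_iter_measurable])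
qed

lemma L2_T_iter:
  assumes "f \<in> L2_functions M"
  shows "(\<lambda>x. f ((T ^^ n) x)) \<in> L2_functions M"
  using assms integrable_T_iter[of "\<lambda>x. (cmod (f x))\<^sup>2" n]
  by (auto simp: L2_functions_def)

lemma integral_norm2_T_iter:
  assumes "f \<in> L2_functions M"
  shows "(\<integral>x. (cmod (f ((T ^^ n) x)))\<^sup>2 \<partial>M) = (\<integral>x. (cmod (f x))\<^sup>2 \<partial>M)"
  by (rule integral_T_iter) (use L2_measurable[OF assms] in measurable)

lemma eigenfunction_L2: "eigenfunction M T e \<Longrightarrow> e \<in> L2_functions M"
  by (simp add: eigenfunction_def)

lemma AE_eigen_iter:
  assumes "AE x in M. e (T x) = (z::complex) * e x"
  shows "AE x in M. e ((T ^^ n) x) = z ^ n * e x"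
proof (induction n)
  case (Suc n)
  from Suc AE_T_iter[OF assms, of n] show ?case
    by eventually_elim simp
qed simp

lemma eigenvalue_cmod:
  assumes "eigenfunction M T e" "AE x in M. e (T x) = z * e x"
  shows "cmod z = 1"
proof -
  have e: "e \<in> L2_functions M" and ne: "\<not> (AE x in M. e x = 0)"
    using assms(1) by (auto simp: eigenfunction_def)
  note [measurable] = L2_measurable[OF e]
  have "(\<integral>x. (cmod (e x))\<^sup>2 \<partial>M) = (\<integral>x. (cmod (e (T x)))\<^sup>2 \<partial>M)"
    using integral_norm2_T_iter[OF e, of 1] by simp
  also have "\<dots> = (\<integral>x. (cmod z)\<^sup>2 * (cmod (e x))\<^sup>2 \<partial>M)"
    by (rule integral_cong_AE) (use assms(2) in \<open>auto simp: norm_mult power_mult_distrib\<close>)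
  finally have "(\<integral>x. (cmod (e x))\<^sup>2 \<partial>M) = (cmod z)\<^sup>2 * (\<integral>x. (cmod (e x))\<^sup>2 \<partial>M)"
    by simp
  moreover have "(\<integral>x. (cmod (e x))\<^sup>2 \<partial>M) \<noteq> 0"
    using ne integral_nonneg_eq_0_iff_AE[OF L2_integrable_norm2[OF e]] by simp
  ultimately show ?thesis
    by (simp add: power2_eq_1_iff) (smt (verit) norm_ge_zero)
qed

section \<open>Invariant functions of an ergodic transformation\<close>

text \<open>Ergodicity concerns sets that are exactly invariant, whereas \<open>{x. h x \<in> B}\<close> is invariant only
  up to a null set. The set of points whose orbit meets \<open>{x. h x \<in> B}\<close> infinitely often
  is exactly invariant, and it differs from \<open>{x. h x \<in> B}\<close> by a null set.\<close>

lemma ergodic_level_set: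
  fixes h :: "'a \<Rightarrow> 'b::topological_space"
  assumes "ergodic M T" and [measurable]: "h \<in> borel_measurable M" "B \<in> sets borel"
    and inv: "AE x in M. h (T x) = h x"
  shows "(AE x in M. h x \<in> B) \<or> (AE x in M. h x \<notin> B)"
proof -
  have inv_n: "AE x in M. h ((T ^^ n) x) = h x" for n
  proof (induction n)
    case (Suc n)
    from Suc AE_T_iter[OF inv, of n] show ?case by eventually_elim simp
  qed simp
  define A where "A = {x \<in> space M. \<forall>m. \<exists>n\<ge>m. h ((T ^^ n) x) \<in> B}"
  have A [measurable]: "A \<in> sets M" unfolding A_def by measurable
  have "(\<forall>m. \<exists>n\<ge>m. h ((T ^^ n) (T x)) \<in> B) \<longleftrightarrow> (\<forall>m. \<exists>n\<ge>m. h ((T ^^ n) x) \<in> B)" for x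
  proof -
    have shift: "(T ^^ n) (T x) = (T ^^ Suc n) x" for n
      by (simp add: funpow_swap1)
    show ?thesis
      unfolding shift
    proof safe
      fix m assume "\<forall>m. \<exists>n\<ge>m. h ((T ^^ Suc n) x) \<in> B"
      then obtain n where "n \<ge> m" "h ((T ^^ Suc n) x) \<in> B" by blast
      then show "\<exists>n\<ge>m. h ((T ^^ n) x) \<in> B" using le_SucI by blast
    next
      fix m assume "\<forall>m. \<exists>n\<ge>m. h ((T ^^ n) x) \<in> B"
      then obtain n where "n \<ge> Suc m" "h ((T ^^ n) x) \<in> B" by blast
      then show "\<exists>n\<ge>m. h ((T ^^ Suc n) x) \<in> B" by (cases n) auto
    qed
  qed
  then have "T -` A \<inter> space M = A"
    using T_iter_space[of _ 1] by (auto simp: A_def)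
  then have "measure M A = 0 \<or> measure M A = 1"
    using assms(1) A by (simp add: ergodic_def)
  then have "(AE x in M. x \<notin> A) \<or> (AE x in M. x \<in> A)"
    using A prob_eq_0[OF A] prob_eq_1[OF A] by auto
  moreover have A_iff: "AE x in M. x \<in> A \<longleftrightarrow> h x \<in> B"
  proof -
    have "AE x in M. \<forall>n. h ((T ^^ n) x) = h x"
      using inv_n by (simp add: AE_all_countable)
    with AE_space show ?thesis
      by eventually_elim (auto simp: A_def)
  qed
  moreover have "AE x in M. h x \<in> B" if "AE x in M. x \<in> A"
    using that A_iff by eventually_elim simp
  moreover have "AE x in M. h x \<notin> B" if "AE x in M. x \<notin> A"
    using that A_iff by eventually_elim simp
  ultimately show ?thesis by blast
qed

text \<open>The level set at the mean suffices: a function that is almost everywhere on one side of its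
  mean is almost everywhere equal to it.\<close>

lemma ergodic_invariant_real_const:
  fixes h :: "'a \<Rightarrow> real"
  assumes erg: "ergodic M T" and int: "integrable M h"
    and inv: "AE x in M. h (T x) = h x"
  shows "AE x in M. h x = expectation h"
proof -
  have [measurable]: "h \<in> borel_measurable M" using int by simp
  have "(AE x in M. h x \<in> {..expectation h}) \<or> (AE x in M. h x \<notin> {..expectation h})"
    by (rule ergodic_level_set[OF erg _ _ inv]) auto
  moreover have "AE x in M. 0 \<le> expectation h - h x" if "AE x in M. h x \<in> {..expectation h}"
    using that by eventually_elim simp
  moreover have "AE x in M. 0 \<le> h x - expectation h" if "AE x in M. h x \<notin> {..expectation h}"
    using that by eventually_elim simp
  ultimately consider "AE x in M. 0 \<le> expectation h - h x" | "AE x in M. 0 \<le> h x - expectation h"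
    by blast
  then show ?thesis
  proof cases
    case 1
    have "(\<integral>x. expectation h - h x \<partial>M) = 0" using int by (simp add: prob_space)
    then have "AE x in M. expectation h - h x = 0"
      using integral_nonneg_eq_0_iff_AE[OF _ 1] int by simp
    then show ?thesis by eventually_elim simp
  next
    case 2
    have "(\<integral>x. h x - expectation h \<partial>M) = 0" using int by (simp add: prob_space)
    then have "AE x in M. h x - expectation h = 0"
      using integral_nonneg_eq_0_iff_AE[OF _ 2] int by simp
    then show ?thesis by eventually_elim simp
  qed
qed

lemma ergodic_invariant_const:
  fixes h :: "'a \<Rightarrow> complex"
  assumes erg: "ergodic M T" and int: "integrable M h"
    and inv: "AE x in M. h (T x) = h x"
  shows "AE x in M. h x = (\<integral>x. h x \<partial>M)"
proof -
  have "AE x in M. Re (h x) = (\<integral>x. Re (h x) \<partial>M)"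
    by (rule ergodic_invariant_real_const[OF erg integrable_Re[OF int]])
       (rule AE_mp[OF inv], simp)
  moreover have "AE x in M. Im (h x) = (\<integral>x. Im (h x) \<partial>M)"
    by (rule ergodic_invariant_real_const[OF erg integrable_Im[OF int]])
       (rule AE_mp[OF inv], simp)
  ultimately show ?thesis
    by eventually_elim (simp add: complex_eq_iff integral_Re[OF int] integral_Im[OF int])
qed

section \<open>Ergodic averages\<close>

definition twisted_average :: "complex \<Rightarrow> nat \<Rightarrow> ('a \<Rightarrow> complex) \<Rightarrow> 'a \<Rightarrow> complex" where
  "twisted_average w N f x = (\<Sum>n<N. w ^ n * f ((T ^^ n) x)) / of_nat N"

lemma L2_twisted_average:
  assumes "f \<in> L2_functions M"
  shows "twisted_average w N f \<in> L2_functions M"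
proof -
  have "(\<lambda>x. inverse (of_nat N) * (\<Sum>n<N. w ^ n * f ((T ^^ n) x))) \<in> L2_functions M"
    by (intro L2_sum L2_cmult L2_T_iter assms)
  then show ?thesis
    by (simp add: twisted_average_def[abs_def] divide_inverse mult.commute)
qed

lemma twisted_average_norm2_le:
  assumes f: "f \<in> L2_functions M" and w: "cmod w = 1"
  shows "(\<integral>x. (cmod (twisted_average w N f x))\<^sup>2 \<partial>M) \<le> (\<integral>x. (cmod (f x))\<^sup>2 \<partial>M)"
proof (cases "N = 0")
  case False
  have "(\<integral>x. (cmod (\<Sum>n<N. w ^ n * f ((T ^^ n) x)))\<^sup>2 \<partial>M)
      \<le> real (card {..<N}) * (\<Sum>n<N. \<integral>x. (cmod (w ^ n * f ((T ^^ n) x)))\<^sup>2 \<partial>M)"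
    by (intro integral_norm2_sum_le L2_cmult L2_T_iter f)
  also have "\<dots> = (real N)\<^sup>2 * (\<integral>x. (cmod (f x))\<^sup>2 \<partial>M)"
    unfolding norm_mult norm_power w power_one mult_1_left integral_norm2_T_iter[OF f]
    by (simp add: power2_eq_square)
  finally show ?thesis
    using False by (simp add: twisted_average_def norm_divide power_divide divide_le_eq mult.commute)
qed (simp add: twisted_average_def)

definition average_deviation :: "nat \<Rightarrow> ('a \<Rightarrow> complex) \<Rightarrow> 'a \<Rightarrow> complex" where
  "average_deviation N f x = twisted_average 1 N f x - (\<integral>y. f y \<partial>M)"

lemma L2_average_deviation:
  "f \<in> L2_functions M \<Longrightarrow> average_deviation N f \<in> L2_functions M"
  unfolding average_deviation_def[abs_def] by (intro L2_diff L2_twisted_average L2_const)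

lemma average_deviation_norm2_le:
  assumes f: "f \<in> L2_functions M"
  shows "(\<integral>x. (cmod (average_deviation N f x))\<^sup>2 \<partial>M) \<le> 4 * (\<integral>x. (cmod (f x))\<^sup>2 \<partial>M)"
proof -
  have "(\<integral>x. (cmod (average_deviation N f x))\<^sup>2 \<partial>M)
      \<le> 2 * (\<integral>x. (cmod (twisted_average 1 N f x))\<^sup>2 \<partial>M)
         + 2 * (\<integral>x. (cmod (- (\<integral>y. f y \<partial>M)))\<^sup>2 \<partial>M)"
    using integral_norm2_add_le[OF L2_twisted_average[OF f] L2_const, of 1 N "- (\<integral>y. f y \<partial>M)"]
    by (simp add: average_deviation_def)
  moreover have "(cmod (\<integral>y. f y \<partial>M))\<^sup>2 \<le> (\<integral>x. (cmod (f x))\<^sup>2 \<partial>M)"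
    using L2_Cauchy_Schwarz[OF f L2_const[of 1]] by (simp add: prob_space)
  ultimately show ?thesis
    using twisted_average_norm2_le[OF f, of 1 N] by (simp add: prob_space)
qed

text \<open>For the eigenvalue \<open>1\<close> the eigenfunction is constant by ergodicity. Otherwise
  its integral vanishes, and its averages are multiples by \<open>(\<Sum>n<N. z ^ n) / N\<close>, which is a bounded
  geometric sum divided by \<open>N\<close>.\<close>

lemma average_deviation_eigenfunction:
  assumes erg: "ergodic M T" and e: "eigenfunction M T e"
  shows "(\<lambda>N. \<integral>x. (cmod (average_deviation N e x))\<^sup>2 \<partial>M) \<longlonglongrightarrow> 0"
proof -
  obtain z where z: "AE x in M. e (T x) = z * e x"
    using e by (auto simp: eigenfunction_def)
  have eL2: "e \<in> L2_functions M" using e by (rule eigenfunction_L2)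
  note [measurable] = L2_measurable[OF eL2]
  have int: "integrable M e" using eL2 by (rule L2_integrable)
  have iter: "AE x in M. \<forall>n. e ((T ^^ n) x) = z ^ n * e x"
    using AE_eigen_iter[OF z] by (simp add: AE_all_countable)
  show ?thesis
  proof (cases "z = 1")
    case True
    have const: "AE x in M. e x = (\<integral>y. e y \<partial>M)"
      using ergodic_invariant_const[OF erg int] z True by simp
    \<comment> \<open>For \<open>N = 0\<close> the average is \<open>0\<close>, since division by zero gives \<open>0\<close>.\<close>
    have "(\<integral>x. (cmod (average_deviation N e x))\<^sup>2 \<partial>M) = 0" if "N > 0" for N
    proof (rule integral_eq_zero_AE)
      from iter const show "AE x in M. (cmod (average_deviation N e x))\<^sup>2 = 0"
        by eventually_elim (use that True in \<open>simp add: average_deviation_def twisted_average_def\<close>)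
    qed
    then show ?thesis
      by (intro tendsto_eventually eventually_sequentiallyI[of 1]) auto
  next
    case False
    have "(\<integral>x. e x \<partial>M) = (\<integral>x. e (T x) \<partial>M)"
      using integral_T_iter[of e 1] by simp
    also have "\<dots> = (\<integral>x. z * e x \<partial>M)"
      by (rule integral_cong_AE) (use z in auto)
    finally have mean0: "(\<integral>x. e x \<partial>M) = 0"
      using False by simp
    define C where "C = (2 / cmod (z - 1))\<^sup>2 * (\<integral>x. (cmod (e x))\<^sup>2 \<partial>M)"
    have bound: "(\<integral>x. (cmod (average_deviation N e x))\<^sup>2 \<partial>M) \<le> C * (1 / real N)\<^sup>2" for N
    proof -
      have "cmod (\<Sum>n<N. z ^ n) \<le> 2 / cmod (z - 1)"
      proof -
        have "cmod (z ^ N - 1) \<le> 2"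
          using norm_triangle_ineq4[of "z ^ N" 1] eigenvalue_cmod[OF e z] by (simp add: norm_power)
        then show ?thesis
          using False by (simp add: geometric_sum norm_divide divide_right_mono)
      qed
      from divide_right_mono[OF this, of "real N"]
      have geo: "cmod ((\<Sum>n<N. z ^ n) / of_nat N) \<le> 2 / cmod (z - 1) * (1 / real N)"
        by (simp add: norm_divide)
      have "(\<integral>x. (cmod (average_deviation N e x))\<^sup>2 \<partial>M)
          \<le> (\<integral>x. (2 / cmod (z - 1) * (1 / real N))\<^sup>2 * (cmod (e x))\<^sup>2 \<partial>M)"
      proof (rule integral_mono_AE)
        from iter show "AE x in M. (cmod (average_deviation N e x))\<^sup>2
            \<le> (2 / cmod (z - 1) * (1 / real N))\<^sup>2 * (cmod (e x))\<^sup>2"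
        proof eventually_elim
          case (elim x)
          then have "average_deviation N e x = (\<Sum>n<N. z ^ n) / of_nat N * e x"
            by (simp add: average_deviation_def twisted_average_def mean0 sum_distrib_right)
          then show ?case
            using geo by (simp only: norm_mult power_mult_distrib[symmetric])
              (intro power_mono mult_right_mono; simp)
        qed
      qed (use L2_integrable_norm2[OF L2_average_deviation[OF eL2]] L2_integrable_norm2[OF eL2] in auto)
      also have "\<dots> = C * (1 / real N)\<^sup>2"
        by (simp add: C_def power_mult_distrib power_divide)
      finally show ?thesis .
    qed
    have "(\<lambda>N. C * (1 / real N)\<^sup>2) \<longlonglongrightarrow> C * 0\<^sup>2"
      by (intro tendsto_intros lim_1_over_n)
    then have lim: "(\<lambda>N. C * (1 / real N)\<^sup>2) \<longlonglongrightarrow> 0" by simp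
    show ?thesis
      by (rule tendsto_sandwich[OF _ _ tendsto_const lim]) (use bound in auto)
  qed
qed

lemma average_deviation_sum:
  assumes "finite E" "\<And>e. e \<in> E \<Longrightarrow> e \<in> L2_functions M"
  shows "average_deviation N (\<lambda>x. \<Sum>e\<in>E. c e * e x) x = (\<Sum>e\<in>E. c e * average_deviation N e x)"
proof -
  have "(\<integral>x. (\<Sum>e\<in>E. c e * e x) \<partial>M) = (\<Sum>e\<in>E. c e * (\<integral>x. e x \<partial>M))"
    using assms by (subst Bochner_Integration.integral_sum) (auto intro: L2_integrable)
  moreover have "twisted_average 1 N (\<lambda>x. \<Sum>e\<in>E. c e * e x) x
      = (\<Sum>e\<in>E. c e * twisted_average 1 N e x)"
    unfolding twisted_average_def
    by (simp add: sum_divide_distrib sum_distrib_left) (rule sum.swap)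
  ultimately show ?thesis
    by (simp add: average_deviation_def right_diff_distrib sum_subtractf)
qed

text \<open>The deviations depend linearly on \<open>f\<close> and are bounded in \<open>L\<^sup>2\<close> uniformly in \<open>N\<close>, so convergence
  passes from the eigenfunctions to their linear combinations and then to the limits of these.\<close>

lemma mean_ergodic_discrete_spectrum:
  assumes erg: "ergodic M T" and ds: "discrete_spectrum M T" and f: "f \<in> L2_functions M"
  shows "(\<lambda>N. \<integral>x. (cmod (average_deviation N f x))\<^sup>2 \<partial>M) \<longlonglongrightarrow> 0"
proof (rule LIMSEQ_I)
  fix \<epsilon> :: real assume "\<epsilon> > 0"
  \<comment> \<open>The square norm of the deviation of \<open>f\<close> is at most \<open>2 * 4\<close> times that of the error
    \<open>r\<close> plus twice that of the deviation of \<open>g\<close>; each part is to stay below \<open>\<epsilon> / 2\<close>.\<close>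
  then have "\<epsilon> / 16 > 0" by simp
  then obtain E c where E: "finite E" "\<And>e. e \<in> E \<Longrightarrow> eigenfunction M T e"
    and close: "(\<integral>x. (cmod (f x - (\<Sum>e\<in>E. c e * e x)))\<^sup>2 \<partial>M) < \<epsilon> / 16"
    by (rule discrete_spectrum_approx[OF ds f]) blast
  define g where "g = (\<lambda>x. \<Sum>e\<in>E. c e * e x)"
  define r where "r = (\<lambda>x. f x - g x)"
  have eL2: "e \<in> L2_functions M" if "e \<in> E" for e
    using E(2)[OF that] by (rule eigenfunction_L2)
  have g: "g \<in> L2_functions M"
    unfolding g_def by (intro L2_sum L2_cmult eL2)
  have r: "r \<in> L2_functions M"
    unfolding r_def by (intro L2_diff f g)
  define G where "G N = real (card E)
    * (\<Sum>e\<in>E. (cmod (c e))\<^sup>2 * (\<integral>x. (cmod (average_deviation N e x))\<^sup>2 \<partial>M))" for N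
  have "G \<longlonglongrightarrow> real (card E) * (\<Sum>e\<in>E. (cmod (c e))\<^sup>2 * 0)"
    unfolding G_def
    by (intro tendsto_intros average_deviation_eigenfunction[OF erg] E(2))
  then have "eventually (\<lambda>N. G N < \<epsilon> / 4) sequentially"
    using \<open>\<epsilon> > 0\<close> by (intro order_tendstoD(2)[where y = 0]) auto
  then obtain N0 where N0: "\<And>N. N \<ge> N0 \<Longrightarrow> G N < \<epsilon> / 4"
    by (auto simp: eventually_sequentially)
  show "\<exists>N0. \<forall>N\<ge>N0. norm ((\<integral>x. (cmod (average_deviation N f x))\<^sup>2 \<partial>M) - 0) < \<epsilon>"
  proof (intro exI allI impI)
    fix N assume "N \<ge> N0"
    have g_le: "(\<integral>x. (cmod (average_deviation N g x))\<^sup>2 \<partial>M) \<le> G N"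
    proof -
      have "(\<integral>x. (cmod (average_deviation N g x))\<^sup>2 \<partial>M)
          = (\<integral>x. (cmod (\<Sum>e\<in>E. c e * average_deviation N e x))\<^sup>2 \<partial>M)"
        using average_deviation_sum[OF E(1) eL2] by (simp add: g_def)
      also have "\<dots> \<le> real (card E) * (\<Sum>e\<in>E. \<integral>x. (cmod (c e * average_deviation N e x))\<^sup>2 \<partial>M)"
        by (intro integral_norm2_sum_le L2_cmult L2_average_deviation eL2)
      finally show ?thesis by (simp add: G_def norm_mult power_mult_distrib)
    qed
    have "average_deviation N f x = average_deviation N r x + average_deviation N g x" for x
      using f g by (simp add: r_def average_deviation_def twisted_average_def
          sum_subtractf diff_divide_distrib L2_integrable)
    then have "(\<integral>x. (cmod (average_deviation N f x))\<^sup>2 \<partial>M)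
        \<le> 2 * (\<integral>x. (cmod (average_deviation N r x))\<^sup>2 \<partial>M)
          + 2 * (\<integral>x. (cmod (average_deviation N g x))\<^sup>2 \<partial>M)"
      using integral_norm2_add_le[OF L2_average_deviation[OF r] L2_average_deviation[OF g]] by simp
    also have "\<dots> < \<epsilon>"
      using average_deviation_norm2_le[OF r, of N] g_le N0[OF \<open>N \<ge> N0\<close>] close
      by (simp add: r_def g_def)
    finally show "norm ((\<integral>x. (cmod (average_deviation N f x))\<^sup>2 \<partial>M) - 0) < \<epsilon>"
      by simp
  qed
qed

section \<open>Functions with nonnegative autocorrelations\<close>

lemma integral_norm2_sum_eq:
  assumes f: "f \<in> L2_functions M"
  shows "(\<integral>x. (cmod (\<Sum>n<N. w ^ n * f ((T ^^ n) x)))\<^sup>2 \<partial>M)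
    = Re (\<Sum>n<N. \<Sum>m<N. w ^ n * cnj w ^ m * (\<integral>x. f ((T ^^ n) x) * cnj (f ((T ^^ m) x)) \<partial>M))"
proof -
  have int: "integrable M (\<lambda>x. f ((T ^^ n) x) * cnj (f ((T ^^ m) x)))" for n m
    by (intro L2_inner_integrable L2_T_iter f)
  have "complex_of_real (\<integral>x. (cmod (\<Sum>n<N. w ^ n * f ((T ^^ n) x)))\<^sup>2 \<partial>M)
      = (\<integral>x. (\<Sum>n<N. \<Sum>m<N. w ^ n * cnj w ^ m * (f ((T ^^ n) x) * cnj (f ((T ^^ m) x)))) \<partial>M)"
    unfolding integral_complex_of_real[symmetric] complex_norm_square
    by (simp add: sum_product mult_ac)
  also have "\<dots> = (\<Sum>n<N. \<Sum>m<N. w ^ n * cnj w ^ m * (\<integral>x. f ((T ^^ n) x) * cnj (f ((T ^^ m) x)) \<partial>M))"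
    by (simp add: Bochner_Integration.integral_sum int)
  finally show ?thesis by (metis Re_complex_of_real)
qed

text \<open>By invariance the correlation of \<open>f \<circ> T\<^sup>n\<close> and \<open>f \<circ> T\<^sup>m\<close> depends only on \<open>n - m\<close>, up to
  conjugation, so it is a nonnegative real for all \<open>n\<close> and \<open>m\<close>. Hence every term of the expanded square norm has
  its largest real part when the phase factor \<open>w ^ n * cnj w ^ m\<close> is replaced by \<open>1\<close>.\<close>

lemma twisted_average_dominated:
  assumes f: "f \<in> L2_functions M" and w: "cmod w \<le> 1"
    and pos: "\<And>n. (\<integral>x. f ((T ^^ n) x) * cnj (f x) \<partial>M) \<in> \<real>\<^sub>\<ge>\<^sub>0"
  shows "(\<integral>x. (cmod (twisted_average w N f x))\<^sup>2 \<partial>M)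
           \<le> (\<integral>x. (cmod (twisted_average 1 N f x))\<^sup>2 \<partial>M)"
proof -
  note [measurable] = L2_measurable[OF f]
  define \<gamma> where "\<gamma> n m = (\<integral>x. f ((T ^^ n) x) * cnj (f ((T ^^ m) x)) \<partial>M)" for n m
  have shift: "\<gamma> (k + m) m \<in> \<real>\<^sub>\<ge>\<^sub>0" for k m
  proof -
    have "\<gamma> (k + m) m = (\<integral>x. f ((T ^^ k) x) * cnj (f x) \<partial>M)"
      unfolding \<gamma>_def funpow_add o_def
      by (rule integral_T_iter[of "\<lambda>x. f ((T ^^ k) x) * cnj (f x)" m]) measurable
    then show ?thesis using pos by simp
  qed
  have sym: "\<gamma> n m = cnj (\<gamma> m n)" for n m
    unfolding \<gamma>_def Bochner_Integration.integral_cnj[symmetric] by (simp add: mult.commute)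
  have \<gamma>: "\<gamma> n m \<in> \<real>\<^sub>\<ge>\<^sub>0" for n m
  proof (cases "m \<le> n")
    case True
    then show ?thesis using shift[of "n - m" m] by simp
  next
    case False
    then have "\<gamma> m n \<in> \<real>\<^sub>\<ge>\<^sub>0" using shift[of "m - n" n] by simp
    then show ?thesis by (subst sym) (auto simp: complex_nonneg_Reals_iff)
  qed
  have "(\<integral>x. (cmod (\<Sum>n<N. w ^ n * f ((T ^^ n) x)))\<^sup>2 \<partial>M)
      = (\<Sum>n<N. \<Sum>m<N. Re (w ^ n * cnj w ^ m * \<gamma> n m))"
    unfolding integral_norm2_sum_eq[OF f] \<gamma>_def by simp
  also have "\<dots> \<le> (\<Sum>n<N. \<Sum>m<N. Re (\<gamma> n m))"
  proof (intro sum_mono)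
    fix n m
    have "Re (w ^ n * cnj w ^ m * \<gamma> n m) \<le> cmod (w ^ n * cnj w ^ m) * cmod (\<gamma> n m)"
      using complex_Re_le_cmod[of "w ^ n * cnj w ^ m * \<gamma> n m"] by (simp only: norm_mult)
    also have "\<dots> \<le> 1 * cmod (\<gamma> n m)"
      using w by (intro mult_right_mono) (auto simp: norm_mult norm_power intro!: mult_le_one power_le_one)
    also have "cmod (\<gamma> n m) = Re (\<gamma> n m)"
      using \<gamma>[of n m] by (auto simp: complex_nonneg_Reals_iff cmod_eq_Re)
    finally show "Re (w ^ n * cnj w ^ m * \<gamma> n m) \<le> Re (\<gamma> n m)" by simp
  qed
  also have "\<dots> = (\<integral>x. (cmod (\<Sum>n<N. 1 ^ n * f ((T ^^ n) x)))\<^sup>2 \<partial>M)"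
    unfolding integral_norm2_sum_eq[OF f] \<gamma>_def by simp
  finally show ?thesis
    by (simp add: twisted_average_def norm_divide power_divide divide_right_mono)
qed

text \<open>The factor \<open>cnj z ^ n\<close> turns \<open>cnj (e x)\<close> into the conjugate of \<open>e\<close> at the \<open>n\<close>-th iterate of
  \<open>x\<close>, and then the invariance of the measure removes the iterate from the integral.\<close>

lemma inner_twisted_average:
  assumes f: "f \<in> L2_functions M" and e: "e \<in> L2_functions M"
    and z: "AE x in M. e (T x) = z * e x" and N: "N > 0"
  shows "(\<integral>x. twisted_average (cnj z) N f x * cnj (e x) \<partial>M) = (\<integral>x. f x * cnj (e x) \<partial>M)"
proof -
  note [measurable] = L2_measurable[OF f] L2_measurable[OF e]
  have int: "integrable M (\<lambda>x. f ((T ^^ n) x) * cnj (e x))" for n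
    by (intro L2_inner_integrable L2_T_iter f e)
  have eq: "cnj z ^ n * (\<integral>x. f ((T ^^ n) x) * cnj (e x) \<partial>M) = (\<integral>x. f x * cnj (e x) \<partial>M)" for n
  proof -
    have "cnj z ^ n * (\<integral>x. f ((T ^^ n) x) * cnj (e x) \<partial>M)
        = (\<integral>x. cnj z ^ n * (f ((T ^^ n) x) * cnj (e x)) \<partial>M)"
      by simp
    also have "\<dots> = (\<integral>x. f ((T ^^ n) x) * cnj (e ((T ^^ n) x)) \<partial>M)"
    proof (rule integral_cong_AE)
      from AE_eigen_iter[OF z, of n]
      show "AE x in M. cnj z ^ n * (f ((T ^^ n) x) * cnj (e x)) = f ((T ^^ n) x) * cnj (e ((T ^^ n) x))"
        by eventually_elim simp
    qed measurable
    also have "\<dots> = (\<integral>x. f x * cnj (e x) \<partial>M)"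
      using integral_T_iter[of "\<lambda>x. f x * cnj (e x)" n] by simp
    finally show ?thesis .
  qed
  have "(\<integral>x. twisted_average (cnj z) N f x * cnj (e x) \<partial>M)
      = (\<integral>x. (\<Sum>n<N. cnj z ^ n * (f ((T ^^ n) x) * cnj (e x))) / of_nat N \<partial>M)"
    unfolding twisted_average_def times_divide_eq_left sum_distrib_right mult.assoc ..
  also have "\<dots> = (\<Sum>n<N. cnj z ^ n * (\<integral>x. f ((T ^^ n) x) * cnj (e x) \<partial>M)) / of_nat N"
    by (simp add: Bochner_Integration.integral_sum int)
  also have "\<dots> = (\<integral>x. f x * cnj (e x) \<partial>M)"
    using N by (simp add: eq)
  finally show ?thesis .
qed

text \<open>By Cauchy-Schwarz the inner product with \<open>e\<close> is bounded by the norm of an average twisted by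
  the conjugate eigenvalue, and thus by that of the untwisted average.\<close>

lemma nonneg_autocorrelation_orthogonal:
  assumes f: "f \<in> L2_functions M" and e: "eigenfunction M T e"
    and pos: "\<And>n. (\<integral>x. f ((T ^^ n) x) * cnj (f x) \<partial>M) \<in> \<real>\<^sub>\<ge>\<^sub>0"
    and lim: "(\<lambda>N. \<integral>x. (cmod (twisted_average 1 N f x))\<^sup>2 \<partial>M) \<longlonglongrightarrow> 0"
  shows "(\<integral>x. f x * cnj (e x) \<partial>M) = 0"
proof -
  obtain z where z: "AE x in M. e (T x) = z * e x"
    using e by (auto simp: eigenfunction_def)
  have eL2: "e \<in> L2_functions M" using e by (rule eigenfunction_L2)
  define K where "K = (\<integral>x. (cmod (e x))\<^sup>2 \<partial>M)"
  have le: "(cmod (\<integral>x. f x * cnj (e x) \<partial>M))\<^sup>2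
      \<le> (\<integral>x. (cmod (twisted_average 1 N f x))\<^sup>2 \<partial>M) * K" if "N > 0" for N
  proof -
    have "(cmod (\<integral>x. f x * cnj (e x) \<partial>M))\<^sup>2
        \<le> (\<integral>x. (cmod (twisted_average (cnj z) N f x))\<^sup>2 \<partial>M) * K"
      using L2_Cauchy_Schwarz[OF L2_twisted_average[OF f] eL2]
        inner_twisted_average[OF f eL2 z that] unfolding K_def by metis
    also have "\<dots> \<le> (\<integral>x. (cmod (twisted_average 1 N f x))\<^sup>2 \<partial>M) * K"
      using eigenvalue_cmod[OF e z]
      by (intro mult_right_mono twisted_average_dominated f pos) (auto simp: K_def)
    finally show ?thesis .
  qed
  have "(\<lambda>N. (\<integral>x. (cmod (twisted_average 1 N f x))\<^sup>2 \<partial>M) * K) \<longlonglongrightarrow> 0"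
    using tendsto_mult_right[OF lim, of K] by simp
  then have "(cmod (\<integral>x. f x * cnj (e x) \<partial>M))\<^sup>2 \<le> 0"
    by (rule LIMSEQ_le_const) (use le in \<open>auto intro!: exI[of _ 1]\<close>)
  then show ?thesis by simp
qed

lemma nonneg_autocorrelation_imp_zero:
  assumes "ergodic M T" and ds: "discrete_spectrum M T" and f: "f \<in> L2_functions M"
    and mean0: "(\<integral>x. f x \<partial>M) = 0"
    and pos: "\<And>n. (\<integral>x. f ((T ^^ n) x) * cnj (f x) \<partial>M) \<in> \<real>\<^sub>\<ge>\<^sub>0"
  shows "(\<integral>x. (cmod (f x))\<^sup>2 \<partial>M) = 0"
proof (rule orthogonal_eigenfunctions_imp_zero[OF ds f])
  fix e assume e: "eigenfunction M T e"
  have "(\<lambda>N. \<integral>x. (cmod (twisted_average 1 N f x))\<^sup>2 \<partial>M) \<longlonglongrightarrow> 0"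
    using mean_ergodic_discrete_spectrum[OF assms(1-3)] by (simp add: average_deviation_def mean0)
  then show "(\<integral>x. f x * cnj (e x) \<partial>M) = 0"
    by (rule nonneg_autocorrelation_orthogonal[OF f e pos])
qed

lemma centred_indicator_autocorrelation:
  fixes A defines "f \<equiv> \<lambda>x. complex_of_real (indicator A x - prob A)"
  assumes A [measurable]: "A \<in> sets M"
  shows "(\<integral>x. f ((T ^^ n) x) * cnj (f x) \<partial>M)
    = complex_of_real (prob ((T ^^ n) -` A \<inter> A) - (prob A)\<^sup>2)"
proof -
  let ?B = "(T ^^ n) -` A \<inter> space M"
  have B [measurable]: "?B \<in> sets M" by measurable
  have AB: "?B \<inter> A = (T ^^ n) -` A \<inter> A"
    using sets.sets_into_space[OF A] by auto
  have "prob ?B = prob A"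
    using measure_distr[OF T_iter_measurable A, of n] by (simp add: T_iter_preserves)
  then have "(\<integral>x. indicator (?B \<inter> A) x - prob A * indicator ?B x - prob A * indicator A x + (prob A)\<^sup>2 \<partial>M)
      = prob ((T ^^ n) -` A \<inter> A) - (prob A)\<^sup>2"
    by (simp add: AB[symmetric] prob_space power2_eq_square integrable_indicat_real)
  moreover have "(\<integral>x. f ((T ^^ n) x) * cnj (f x) \<partial>M) = (\<integral>x. complex_of_real
      (indicator (?B \<inter> A) x - prob A * indicator ?B x - prob A * indicator A x + (prob A)\<^sup>2) \<partial>M)"
    by (rule Bochner_Integration.integral_cong)
       (auto simp: f_def indicator_def power2_eq_square algebra_simps)
  ultimately show ?thesis by (simp only: integral_complex_of_real)
qed

end

lemma inv_into_funpow_image: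
  assumes "bij_betw T S S" "A \<subseteq> S"
  shows "(inv_into S T ^^ n) ` A = (T ^^ n) -` A \<inter> S"
proof -
  have inv_S: "inv_into S T y \<in> S" "T (inv_into S T y) = y" if "y \<in> S" for y
    using assms(1) that by (auto simp: bij_betw_def inv_into_into f_inv_into_f)
  have 1: "(inv_into S T ^^ n) y \<in> S \<and> (T ^^ n) ((inv_into S T ^^ n) y) = y" if "y \<in> S" for y
  proof (induction n)
    case (Suc n)
    let ?x = "(inv_into S T ^^ n) y"
    have "(T ^^ Suc n) ((inv_into S T ^^ Suc n) y) = (T ^^ n) (T (inv_into S T ?x))"
      by (simp only: funpow_Suc_right[of n T] funpow.simps(2)[of n "inv_into S T"] o_apply)
    then show ?case using Suc inv_S[of ?x] by simp
  qed (use that in simp)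
  have 2: "(T ^^ n) x \<in> S \<and> (inv_into S T ^^ n) ((T ^^ n) x) = x" if "x \<in> S" for x
  proof (induction n)
    case (Suc n)
    have "T ((T ^^ n) x) \<in> S" "inv_into S T (T ((T ^^ n) x)) = (T ^^ n) x"
      using Suc assms(1) by (auto simp: bij_betw_def)
    then show ?case using Suc by (simp add: funpow_swap1[of "inv_into S T"])
  qed (use that in simp)
  show ?thesis
  proof safe
    fix x assume "(T ^^ n) x \<in> A" "x \<in> S"
    then show "x \<in> (inv_into S T ^^ n) ` A" using 2[of x] by (metis imageI)
  qed (use 1 assms(2) in auto)
qed

theorem proposition3p3:
  fixes M :: "'a measure" and T :: "'a \<Rightarrow> 'a"
  assumes "lebesgue_probability_space M"
    and "invertible_mpt M T"
    and "ergodic M T"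
    and "discrete_spectrum M T"
  shows "\<not> (\<exists>A. over_recurrent M T A)"
proof
  assume "\<exists>A. over_recurrent M T A"
  then obtain A where A [measurable]: "A \<in> sets M" and pos: "0 < measure M A" "measure M A < 1"
    and rec: "\<And>n. (measure M A)\<^sup>2 \<le> measure M (int_iterate M T n ` A \<inter> A)"
    by (auto simp: over_recurrent_def)
  have bij: "bij_betw T (space M) (space M)"
    using assms(2) by (simp add: invertible_mpt_def)
  interpret prob_space M
    using assms(1) by (simp add: lebesgue_probability_space_def)
  interpret measure_preserving M T
    by unfold_locales (use assms(2) in \<open>auto simp: invertible_mpt_def\<close>)
  \<comment> \<open>The images of \<open>A\<close> under the iterates of the inverse are preimages under those of \<open>T\<close>.\<close>
  have corr: "(prob A)\<^sup>2 \<le> prob ((T ^^ n) -` A \<inter> A)" for n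
  proof -
    have "int_iterate M T (- int n) ` A = (inv_into (space M) T ^^ n) ` A"
      by (cases "n = 0") (auto simp: int_iterate_def)
    then have "int_iterate M T (- int n) ` A \<inter> A = (T ^^ n) -` A \<inter> A"
      using inv_into_funpow_image[OF bij sets.sets_into_space[OF A]] sets.sets_into_space[OF A] by auto
    then show ?thesis using rec[of "- int n"] by simp
  qed
  define f where "f = (\<lambda>x. complex_of_real (indicator A x - prob A))"
  have f: "f \<in> L2_functions M"
  proof -
    have "(\<lambda>x. complex_of_real (indicator A x)) \<in> L2_functions M"
      by (auto simp: L2_functions_def indicator_def power2_eq_square
          intro!: integrable_const_bound[of _ 1])
    from L2_diff[OF this L2_const[of "complex_of_real (prob A)"]] show ?thesis
      by (simp add: f_def)
  qed
  have "(\<integral>x. f x \<partial>M) = 0"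
    unfolding f_def integral_complex_of_real
    by (subst Bochner_Integration.integral_diff) (simp_all add: prob_space integrable_indicat_real)
  moreover have "(\<integral>x. f ((T ^^ n) x) * cnj (f x) \<partial>M) \<in> \<real>\<^sub>\<ge>\<^sub>0" for n
    unfolding f_def centred_indicator_autocorrelation[OF A] nonneg_Reals_of_real_iff using corr by simp
  ultimately have "(\<integral>x. (cmod (f x))\<^sup>2 \<partial>M) = 0"
    by (rule nonneg_autocorrelation_imp_zero[OF assms(3,4) f])
  moreover have "complex_of_real (\<integral>x. (cmod (f x))\<^sup>2 \<partial>M) = (\<integral>x. f x * cnj (f x) \<partial>M)"
    unfolding integral_complex_of_real[symmetric] complex_norm_square ..
  \<comment> \<open>The square norm of \<open>f\<close> is its autocorrelation at \<open>n = 0\<close>.\<close>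
  moreover have "(\<integral>x. f x * cnj (f x) \<partial>M) = complex_of_real (prob A - (prob A)\<^sup>2)"
    using centred_indicator_autocorrelation[OF A, of 0] by (simp add: f_def)
  ultimately have "complex_of_real (prob A - (prob A)\<^sup>2) = 0" by simp
  then have "prob A * (1 - prob A) = 0"
    unfolding of_real_eq_0_iff by (simp add: power2_eq_square algebra_simps)
  with pos show False by simp
qed

end
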